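(* Let $k$ be a field of characteristic zero, $R = k[x_1,\dots,x_n]$ and $I =(x_1^{a_1},\dots,x_n^{a_n}, x_1^{p_1}\cdots x_n^{p_n})$ with $0 \leq p_i < a_i$ for all $i$. If the Hilbert series of $A = R/I$ is symmetric, then $A$ has the strong Lefschetz property.
   Context: A standard graded Artinian $k$-algebra $A$ has the strong Lefschetz property if there is $\ell\in A_1$ such that for all $t\geq1$ and all $i$ the map $\cdot\ell^t:A_i\to A_{i+t}$ is injective or surjective. With $h_i=\dim_k A_i$ nonzero exactly for $p\leq i\leq q$ ($h_p,h_q\ne 0$), the Hilbert series is symmetric if $h_{p+i}=h_{q-i}$ for all $i$. *)

theory Defs
  imports Complex_Main "HOL-Library.Poly_Mapping"
begin

text \<open>Polynomial ring: k[x_0, ..., x_(n-1)] is modelled inside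
  the commutative ring of finitely supported functions from monomials
  (exponent vectors nat =>0 nat) to coefficients in k.\<close>

type_synonym 'k mpoly = "(nat \<Rightarrow>\<^sub>0 nat) \<Rightarrow>\<^sub>0 'k"

definition pscale :: "'k::comm_ring_1 \<Rightarrow> 'k mpoly \<Rightarrow> 'k mpoly" where
  "pscale c f = Poly_Mapping.single 0 c * f"

definition mdeg :: "(nat \<Rightarrow>\<^sub>0 nat) \<Rightarrow> nat" where
  "mdeg m = (\<Sum>j\<in>Poly_Mapping.keys m. Poly_Mapping.lookup m j)"

definition polyring :: "nat \<Rightarrow> ('k::comm_ring_1) mpoly set" where
  "polyring n = {f. \<forall>m\<in>Poly_Mapping.keys f. Poly_Mapping.keys m \<subseteq> {..<n}}"

definition hom_comp :: "nat \<Rightarrow> nat \<Rightarrow> ('k::comm_ring_1) mpoly set" where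
  "hom_comp n d = {f \<in> polyring n. \<forall>m\<in>Poly_Mapping.keys f. mdeg m = d}"

definition xmon :: "nat \<Rightarrow> (nat \<Rightarrow> nat) \<Rightarrow> ('k::comm_ring_1) mpoly" where
  "xmon n e = Poly_Mapping.single (\<Sum>j<n. Poly_Mapping.single j (e j)) 1"

definition gens :: "nat \<Rightarrow> (nat \<Rightarrow> nat) \<Rightarrow> (nat \<Rightarrow> nat) \<Rightarrow> nat \<Rightarrow> ('k::comm_ring_1) mpoly" where
  "gens n a p j = (if j < n then xmon n ((\<lambda>_. 0)(j := a j)) else xmon n p)"

definition the_ideal :: "nat \<Rightarrow> (nat \<Rightarrow> nat) \<Rightarrow> (nat \<Rightarrow> nat) \<Rightarrow> ('k::comm_ring_1) mpoly set" where
  "the_ideal n a p = {f. \<exists>h. (\<forall>j\<le>n. h j \<in> polyring n) \<and> f = (\<Sum>j\<le>n. h j * gens n a p j)}"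

text \<open>Hilbert function of A = R/I: h_d = dim_k A_d = dim_k R_d - dim_k (I \<inter> R_d).\<close>
definition hilb :: "nat \<Rightarrow> (nat \<Rightarrow> nat) \<Rightarrow> (nat \<Rightarrow> nat) \<Rightarrow> 'k::field itself \<Rightarrow> nat \<Rightarrow> nat" where
  "hilb n a p (_ :: 'k itself) d =
     vector_space.dim (pscale :: 'k \<Rightarrow> 'k mpoly \<Rightarrow> 'k mpoly) (hom_comp n d)
     - vector_space.dim (pscale :: 'k \<Rightarrow> 'k mpoly \<Rightarrow> 'k mpoly) (hom_comp n d \<inter> the_ideal n a p)"

definition hilb_symmetric :: "(nat \<Rightarrow> nat) \<Rightarrow> bool" where
  "hilb_symmetric h \<longleftrightarrow>
     (\<exists>p0 q0. h p0 \<noteq> 0 \<and> h q0 \<noteq> 0 \<and> (\<forall>i. h i \<noteq> 0 \<longrightarrow> p0 \<le> i \<and> i \<le> q0) \<and>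
        (\<forall>i\<le>q0 - p0. h (p0 + i) = h (q0 - i)))"

text \<open>Strong Lefschetz property of A = R/I: there is a linear form l (a class in A_1,
  represented by an element of R_1) such that for all t >= 1 and all degrees i the
  induced map (. l^t) : A_i -> A_(i+t) is injective or surjective.
  Injective: for f in R_i, l^t f in I implies f in I.
  Surjective: every g in R_(i+t) is congruent mod I to l^t f for some f in R_i.\<close>
definition has_SLP :: "nat \<Rightarrow> (nat \<Rightarrow> nat) \<Rightarrow> (nat \<Rightarrow> nat) \<Rightarrow> 'k::field itself \<Rightarrow> bool" where
  "has_SLP n a p (_ :: 'k itself) \<longleftrightarrow>
     (\<exists>l :: 'k mpoly. l \<in> hom_comp n 1 \<and>
       (\<forall>t\<ge>1. \<forall>i.
          (\<forall>f\<in>hom_comp n i. l ^ t * f \<in> the_ideal n a p \<longrightarrow> f \<in> the_ideal n a p) \<or>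
          (\<forall>g\<in>hom_comp n (i + t). \<exists>f\<in>hom_comp n i. g - l ^ t * f \<in> the_ideal n a p)))"

end

theory Submission
  imports Defs
begin

text \<open>
  The Lefschetz element is the sum \<open>l\<close> of the variables. If some \<open>p j\<close> is positive, choose such
  a \<open>j\<close> with \<open>a j - p j\<close> minimal. The quotient of \<open>A\<close> by the image of \<open>x_j ^ p_j\<close> is a monomial
  complete intersection, whose socle degree is the top degree \<open>c\<close> of \<open>A\<close> by the choice of \<open>j\<close>.
  Hence its Hilbert function is symmetric about \<open>c / 2\<close>, like that of \<open>A\<close>, and so is that of the
  kernel, the ideal of \<open>A\<close> generated by \<open>x_j ^ p_j\<close>. Iterating, \<open>A\<close> is filtered by shifted monomial
  complete intersections that are all centred at \<open>c / 2\<close>. On each of them multiplication by \<open>l\<close>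
  is the raising operator of an \<open>sl2\<close>-action, so \<open>l ^ (c - 2 d)\<close> is injective in degree \<open>d\<close>.
  Injectivity passes through the filtration, and symmetry turns it into bijectivity.
\<close>

section \<open>Lowering operators and injectivity of powers\<close>

text \<open>The operators of the locale below are only assumed additive. This suffices because every
  coefficient in the commutator relation is an integer.\<close>

lemma additive_of_int_mult:
  fixes E :: "'r::ring_1 \<Rightarrow> 'r"
  assumes add: "\<And>x y. E (x + y) = E x + E y"
  shows "E (of_int k * x) = of_int k * E x"
proof -
  have zero: "E 0 = 0" using add[of 0 0] by simp
  have minus: "E (- y) = - E y" for y
    using add[of y "- y"] zero by (simp add: eq_neg_iff_add_eq_0 add.commute)
  have nat: "E (of_nat j * x) = of_nat j * E x" for j
    by (induction j) (simp_all add: zero add algebra_simps)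
  show ?thesis
    by (cases k rule: int_cases2) (simp_all add: nat minus)
qed

text \<open>The commutator of \<open>F\<close> and \<open>E\<close> acts on \<open>V d\<close> by
  \<open>c - 2 * d\<close>, as in an sl2-module with integral weights. An integral domain of
  characteristic zero lets nonzero integers be cancelled. Degrees are natural numbers, so
  \<open>F_V0\<close> states separately that nothing lies below degree zero.\<close>

locale graded_sl2 =
  fixes V :: "nat \<Rightarrow> 'r::{idom, ring_char_0} set"
    and E F :: "'r \<Rightarrow> 'r" and c :: nat
  assumes V_add: "x \<in> V d \<Longrightarrow> y \<in> V d \<Longrightarrow> x + y \<in> V d"
    and V_of_int: "x \<in> V d \<Longrightarrow> of_int k * x \<in> V d"
    and E_V: "x \<in> V d \<Longrightarrow> E x \<in> V (Suc d)"
    and F_V: "x \<in> V (Suc d) \<Longrightarrow> F x \<in> V d"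
    and F_V0: "x \<in> V 0 \<Longrightarrow> F x = 0"
    and E_add: "E (x + y) = E x + E y"
    and F_add: "F (x + y) = F x + F y"
    and commutator: "x \<in> V d \<Longrightarrow> F (E x) = E (F x) + of_int (int c - 2 * int d) * x"
begin

lemma E_zero: "E 0 = 0" and F_zero: "F 0 = 0"
  using E_add[of 0 0] F_add[of 0 0] by simp_all

lemma E_pow_V: "x \<in> V d \<Longrightarrow> (E ^^ s) x \<in> V (d + s)"
  by (induction s) (auto intro: E_V)

lemma E_pow_add: "(E ^^ s) (x + y) = (E ^^ s) x + (E ^^ s) y"
  by (induction s) (auto simp: E_add)

text \<open>Moving \<open>F\<close> past the copy of \<open>E\<close> that acts in degree
  \<open>d + j\<close> costs \<open>c - 2 * (d + j)\<close>. Summing over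
  \<open>j = 0, ..., s\<close> gives the coefficient.\<close>

lemma commutator_pow:
  assumes "x \<in> V d"
  shows "F ((E ^^ Suc s) x) =
    (E ^^ Suc s) (F x) + of_int (int (Suc s) * (int c - 2 * int d - int s)) * (E ^^ s) x"
proof (induction s)
  case 0
  then show ?case using commutator[OF assms] by simp
next
  case (Suc s)
  have "F ((E ^^ Suc (Suc s)) x) =
      E (F ((E ^^ Suc s) x)) + of_int (int c - 2 * int (d + Suc s)) * (E ^^ Suc s) x"
    using commutator[OF E_pow_V[OF assms, of "Suc s"]] by simp
  also have "E (F ((E ^^ Suc s) x)) = (E ^^ Suc (Suc s)) (F x) +
      of_int (int (Suc s) * (int c - 2 * int d - int s)) * (E ^^ Suc s) x"
    unfolding Suc.IH E_add using additive_of_int_mult[of E, OF E_add]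
    by (simp del: of_int_mult of_int_diff of_int_add of_int_of_nat_eq)
  finally show ?case
    by (simp add: algebra_simps)
qed

text \<open>If \<open>E^(s+1) x = 0\<close>, commuting \<open>F\<close> past \<open>E^(s+1)\<close> shows that \<open>E^s\<close> kills \<open>E F x + k x\<close> with an
  integer \<open>k > 0\<close>; so \<open>E F x = - k x\<close>, and then \<open>E^(s+2)\<close> kills \<open>F x\<close>, which has smaller degree.\<close>

lemma E_pow_injective:
  assumes "x \<in> V d" "(E ^^ s) x = 0" "s + 2 * d \<le> c"
  shows "x = 0"
  using assms
proof (induction d arbitrary: s x rule: less_induct)
  case d: (less d)
  show ?case using d.prems
  proof (induction s arbitrary: x)
    case 0
    then show ?case by simp
  next
    case (Suc s)
    define k where "k = int (Suc s) * (int c - 2 * int d - int s)"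
    have k: "k \<noteq> 0" using Suc.prems(3) by (auto simp: k_def)
    have EF: "E (F x) \<in> V d"
    proof (cases d)
      case 0
      then show ?thesis
        using F_V0 Suc.prems(1) V_of_int[of x d 0] E_zero by simp
    next
      case (Suc d')
      then show ?thesis using Suc.prems E_V F_V by blast
    qed
    have "(E ^^ s) (E (F x) + of_int k * x) = F ((E ^^ Suc s) x)"
      unfolding commutator_pow[OF Suc.prems(1)] E_pow_add k_def
      using additive_of_int_mult[of "E ^^ s", OF E_pow_add]
      by (simp add: funpow_swap1 del: of_int_mult of_int_diff of_int_add of_int_of_nat_eq)
    also have "\<dots> = 0" using Suc.prems(2) F_zero by simp
    finally have EF_eq: "E (F x) + of_int k * x = 0"
      using Suc.IH[OF V_add[OF EF V_of_int[OF Suc.prems(1)]]] Suc.prems(3) by simp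
    have "F x = 0"
    proof (cases d)
      case 0
      then show ?thesis using F_V0 Suc.prems(1) by simp
    next
      case (Suc d')
      have "(E ^^ Suc s) (E (F x) + of_int k * x) = (E ^^ Suc (Suc s)) (F x)"
        using Suc.prems(2) additive_of_int_mult[of "E ^^ Suc s", OF E_pow_add]
        by (simp only: E_pow_add) (simp add: funpow_swap1)
      moreover have "(E ^^ Suc s) 0 = 0"
        using E_pow_add[of "Suc s" 0 0] by simp
      ultimately have "(E ^^ Suc (Suc s)) (F x) = 0" using EF_eq by metis
      \<comment> \<open>The induction on the degree applies: two more applications of
        \<open>E\<close> are offset by the lower degree, since
        \<open>Suc (Suc s) + 2 * d' = s + 2 * d\<close>.\<close>
      then show ?thesis
        using d.IH[of d' "F x" "Suc (Suc s)"] F_V Suc Suc.prems by auto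
    qed
    then show ?case using EF_eq E_zero k by simp
  qed
qed

end

section \<open>Coefficients and truncation\<close>

abbreviation lookup where "lookup \<equiv> Poly_Mapping.lookup"
abbreviation keys where "keys \<equiv> Poly_Mapping.keys"
abbreviation unit_vec :: "nat \<Rightarrow> nat \<Rightarrow>\<^sub>0 nat" where "unit_vec i \<equiv> Poly_Mapping.single i (Suc 0)"

lemma sum_single_keys:
  assumes "finite K" "keys f \<subseteq> K"
  shows "f = (\<Sum>k\<in>K. Poly_Mapping.single k (lookup f k))"
proof (rule poly_mapping_eqI)
  fix m
  have "lookup (\<Sum>k\<in>K. Poly_Mapping.single k (lookup f k)) m = (\<Sum>k\<in>K. if k = m then lookup f m else 0)"
    by (auto simp: lookup_sum lookup_single when_def intro!: sum.cong)
  also have "\<dots> = lookup f m"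
    using assms by (auto simp: not_in_keys_iff_lookup_eq_zero)
  finally show "lookup f m = lookup (\<Sum>k\<in>K. Poly_Mapping.single k (lookup f k)) m" ..
qed

text \<open>Subtraction of exponent vectors truncates at zero, so \<open>m - t\<close> is a true
  quotient of monomials only under divisibility.\<close>

lemma add_eq_iff_minus:
  fixes t m k :: "nat \<Rightarrow>\<^sub>0 nat"
  shows "t + k = m \<longleftrightarrow> (\<forall>i. lookup t i \<le> lookup m i) \<and> k = m - t"
  by (simp add: poly_mapping_eq_iff fun_eq_iff lookup_add lookup_minus)
    (metis add_diff_cancel_left' le_add1 le_add_diff_inverse)

lemma lookup_single_mult:
  fixes f :: "'k::comm_ring_1 mpoly"
  shows "lookup (Poly_Mapping.single t a * f) m = (if \<forall>i. lookup t i \<le> lookup m i then a * lookup f (m - t) else 0)"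
proof -
  define P where "P \<longleftrightarrow> (\<forall>i. lookup t i \<le> lookup m i)"
  have iff: "t + k = m \<longleftrightarrow> P \<and> k = m - t" for k
    unfolding P_def by (rule add_eq_iff_minus)
  have "lookup (Poly_Mapping.single t a * f) m =
      lookup (Poly_Mapping.single t a * (\<Sum>k\<in>keys f. Poly_Mapping.single k (lookup f k))) m"
    using sum_single_keys[of "keys f" f] by simp
  also have "\<dots> = (\<Sum>k\<in>keys f. if k = m - t then (if P then a * lookup f k else 0) else 0)"
    by (auto simp: sum_distrib_left mult_single lookup_sum lookup_single when_def iff intro!: sum.cong)
  also have "\<dots> = (if P then a * lookup f (m - t) else 0)"
    by (auto simp: not_in_keys_iff_lookup_eq_zero)
  finally show ?thesis unfolding P_def .
qed

lemma lookup_const_mult: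
  "lookup (Poly_Mapping.single 0 a * f) m = a * lookup f m" for f :: "'k::comm_ring_1 mpoly"
  by (simp add: lookup_single_mult)

lemma lookup_of_int_mult:
  "lookup (of_int k * f) m = of_int k * lookup f m" for f :: "'k::comm_ring_1 mpoly"
  using lookup_const_mult[of "of_int k" f m] by simp

section \<open>The linear form and projections onto sets of monomials\<close>

definition lin :: "nat \<Rightarrow> 'k::comm_ring_1 mpoly" where
  "lin n = (\<Sum>i<n. Poly_Mapping.single (unit_vec i) 1)"

lemma lookup_lin_mult:
  "lookup (lin n * f) m = (\<Sum>i<n. if 0 < lookup m i then lookup f (m - unit_vec i) else 0)"
proof -
  have "(\<forall>j. lookup (unit_vec i) j \<le> lookup m j) \<longleftrightarrow> 0 < lookup m i" for i
    by (auto simp: lookup_single when_def)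
  then show ?thesis
    by (auto simp: lin_def sum_distrib_right lookup_sum lookup_single_mult intro!: sum.cong)
qed

definition trunc :: "(nat \<Rightarrow>\<^sub>0 nat) set \<Rightarrow> 'k::comm_ring_1 mpoly \<Rightarrow> 'k mpoly" where
  "trunc M f = Poly_Mapping.mapp (\<lambda>m x. if m \<in> M then x else 0) f"

lemma lookup_trunc: "lookup (trunc M f) m = (if m \<in> M then lookup f m else 0)"
  by (auto simp: trunc_def lookup_mapp when_def in_keys_iff)

lemma trunc_add: "trunc M (f + g) = trunc M f + trunc M g"
  by (auto intro!: poly_mapping_eqI simp: lookup_trunc lookup_add)

lemma trunc_diff: "trunc M (f - g) = trunc M f - trunc M g"
  by (auto intro!: poly_mapping_eqI simp: lookup_trunc lookup_minus)

lemma trunc_eq_0_iff: "trunc M f = 0 \<longleftrightarrow> (\<forall>m\<in>M. lookup f m = 0)"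
  by (auto simp: poly_mapping_eq_iff fun_eq_iff lookup_trunc)

lemma trunc_keys: "keys f \<subseteq> M \<Longrightarrow> trunc M f = f"
  by (auto intro!: poly_mapping_eqI simp: lookup_trunc in_keys_iff subset_iff)

lemma keys_trunc: "keys (trunc M f) = keys f \<inter> M"
  by (auto simp: in_keys_iff lookup_trunc split: if_splits)

section \<open>Degrees of monomials\<close>

lemma mdeg_superset:
  assumes "finite K" "keys m \<subseteq> K"
  shows "mdeg m = (\<Sum>j\<in>K. lookup m j)"
  unfolding mdeg_def using assms
  by (intro sum.mono_neutral_left) (auto simp: in_keys_iff)

lemma mdeg_add: "mdeg (x + y) = mdeg x + mdeg y"
proof -
  let ?K = "keys x \<union> keys y"
  have "mdeg (x + y) = (\<Sum>j\<in>?K. lookup (x + y) j)"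
    by (intro mdeg_superset) (auto simp: in_keys_iff lookup_add)
  then show ?thesis
    using mdeg_superset[of ?K x] mdeg_superset[of ?K y] by (simp add: lookup_add sum.distrib)
qed

lemma mdeg_unit_vec: "mdeg (unit_vec i) = 1"
  by (simp add: mdeg_def)

lemma minus_unit_vec_add: "0 < lookup m i \<Longrightarrow> m - unit_vec i + unit_vec i = m"
  by (auto intro!: poly_mapping_eqI simp: lookup_add lookup_minus lookup_single when_def)

lemma mdeg_minus_unit_vec: "0 < lookup m i \<Longrightarrow> Suc (mdeg (m - unit_vec i)) = mdeg m"
  using mdeg_add[of "m - unit_vec i" "unit_vec i"] by (simp add: minus_unit_vec_add mdeg_unit_vec)

definition slice :: "(nat \<Rightarrow>\<^sub>0 nat) set \<Rightarrow> nat \<Rightarrow> (nat \<Rightarrow>\<^sub>0 nat) set" where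
  "slice M d = {m \<in> M. mdeg m = d}"

lemma slice_subset: "slice M d \<subseteq> M"
  by (auto simp: slice_def)

lemma keys_subset_iff: "keys f \<subseteq> A \<longleftrightarrow> (\<forall>m. m \<notin> A \<longrightarrow> lookup f m = 0)"
  by (auto simp: in_keys_iff)

text \<open>The span of \<open>M\<close> stands for a subquotient of the polynomial ring on which \<open>l\<close> acts; \<open>c\<close> is twice
  its centre of symmetry. The action is multiplication followed by \<open>trunc M\<close>.\<close>

definition lefschetz_on :: "'k::comm_ring_1 itself \<Rightarrow> nat \<Rightarrow> (nat \<Rightarrow>\<^sub>0 nat) set \<Rightarrow> nat \<Rightarrow> bool" where
  "lefschetz_on _ n M c \<longleftrightarrow> (\<forall>d s (f :: 'k mpoly).
     keys f \<subseteq> slice M d \<longrightarrow> s + 2 * d \<le> c \<longrightarrow> trunc M (lin n ^ s * f) = 0 \<longrightarrow> f = 0)"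

section \<open>Boxes of monomials\<close>

text \<open>For \<open>l = 0\<close> this is the monomial basis of the complete intersection by the
  powers \<open>x_i ^ r i\<close>. In general it is such a basis for the exponents
  \<open>r i - l i\<close>, shifted by the monomial with exponents \<open>l i\<close>.\<close>

definition box :: "nat \<Rightarrow> (nat \<Rightarrow> nat) \<Rightarrow> (nat \<Rightarrow> nat) \<Rightarrow> (nat \<Rightarrow>\<^sub>0 nat) set" where
  "box n l r = {u. (\<forall>i<n. l i \<le> lookup u i \<and> lookup u i < r i) \<and> (\<forall>i\<ge>n. lookup u i = 0)}"

lemma mdeg_lt: "(\<And>i. i \<ge> n \<Longrightarrow> lookup u i = 0) \<Longrightarrow> mdeg u = (\<Sum>i<n. lookup u i)"
  by (rule mdeg_superset) (auto simp: in_keys_iff not_less[symmetric])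

lemma mdeg_box: "u \<in> box n l r \<Longrightarrow> mdeg u = (\<Sum>i<n. lookup u i)"
  by (rule mdeg_lt) (auto simp: box_def)

lemma finite_box: "finite (box n l r)"
proof (rule finite_imageD)
  show "inj_on lookup (box n l r)" by (auto intro: inj_onI)
  have "lookup ` box n l r \<subseteq> {f. \<forall>i. (i \<in> {..<n} \<longrightarrow> f i \<in> {..<Max (r ` {..<n})}) \<and> (i \<notin> {..<n} \<longrightarrow> f i = 0)}"
    by (auto simp: box_def intro: less_le_trans)
  then show "finite (lookup ` box n l r)"
    using finite_set_of_finite_funs[of "{..<n}" "{..<Max (r ` {..<n})}" 0] finite_subset by blast
qed

text \<open>The coefficients of the lowering operator on the string \<open>x^a, \<dots>, x^(b-1)\<close>; both ends get weight
  zero, including the truncated \<open>b - x\<close> at \<open>x = b\<close>.\<close>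

definition weight :: "nat \<Rightarrow> nat \<Rightarrow> nat \<Rightarrow> nat" where
  "weight a b x = (x - a) * (b - x)"

text \<open>A box is a tensor product of strings, one for each variable, and this is the sum of
  their lowering operators. It is written by coefficients: \<open>u\<close> receives from
  \<open>u + unit_vec i\<close> with the weight at the source exponent.\<close>

definition lower :: "nat \<Rightarrow> (nat \<Rightarrow> nat) \<Rightarrow> (nat \<Rightarrow> nat) \<Rightarrow> 'k::comm_ring_1 mpoly \<Rightarrow> 'k mpoly" where
  "lower n l r f = (\<Sum>u\<in>box n l r. Poly_Mapping.single u
     (\<Sum>i<n. of_nat (weight (l i) (r i) (Suc (lookup u i))) * lookup f (u + unit_vec i)))"

lemma lookup_lower:
  "lookup (lower n l r f) u = (if u \<in> box n l r
     then \<Sum>i<n. of_nat (weight (l i) (r i) (Suc (lookup u i))) * lookup f (u + unit_vec i) else 0)"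
  by (simp add: lower_def lookup_sum lookup_single when_def finite_box)

text \<open>The sl2 relation on one string: going up and then down from \<open>x\<close> picks up
  the weight at \<open>Suc x\<close>, going down and then up the weight at \<open>x\<close>.\<close>

lemma weight_diff:
  assumes "a \<le> x" "x < b"
  shows "int (weight a b (Suc x)) = int (weight a b x) + (int a + int b - 1 - 2 * int x)"
proof -
  obtain v where v: "x = a + v" using assms(1) le_Suc_ex by blast
  obtain y where y: "b = Suc (x + y)" using assms(2) less_iff_Suc_add by blast
  show ?thesis unfolding weight_def v y by (simp add: algebra_simps)
qed

text \<open>Operators in different variables commute, so only the one-string commutators remain.
  They add up to the sum of \<open>l i + r i - 1 - 2 * lookup u i\<close>, which is
  \<open>c - 2 * mdeg u\<close>. The assumption \<open>c\<close> states \<open>c\<close> as the sum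
  of all \<open>l i + r i - 1\<close> without a subtraction.\<close>

lemma lower_raise_commutator:
  fixes f :: "'k::comm_ring_1 mpoly"
  assumes f: "keys f \<subseteq> slice (box n l r) d" and c: "c + n = (\<Sum>i<n. l i + r i)"
  defines "E \<equiv> \<lambda>f. trunc (box n l r) (lin n * f)" and "F \<equiv> lower n l r"
  shows "F (E f) = E (F f) + of_int (int c - 2 * int d) * f"
proof (rule poly_mapping_eqI)
  fix u
  let ?B = "box n l r"
  let ?w = "\<lambda>i x. of_nat (weight (l i) (r i) x) :: 'k"
  have f0: "lookup f u = 0" if "u \<notin> slice ?B d" for u
    using f that by (auto simp: in_keys_iff subset_iff)
  have f0': "lookup f u = 0" if "u \<notin> ?B" for u
    using f0 that by (auto simp: slice_def)
  show "lookup (F (E f)) u = lookup (E (F f) + of_int (int c - 2 * int d) * f) u"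
  proof (cases "u \<in> ?B")
    case False
    then show ?thesis using f0'[OF False]
      by (simp add: lookup_add lookup_of_int_mult E_def F_def lookup_lower lookup_trunc del: of_int_diff)
  next
    case True
    \<comment> \<open>\<open>S i j\<close> is the part of the coefficient at \<open>u\<close> that
      comes from lowering in variable \<open>j\<close> and then raising in variable
      \<open>i\<close>; \<open>T i j\<close> is the part for the opposite order.\<close>
    define S where "S i j = (if 0 < lookup u i \<and> u - unit_vec i \<in> ?B
      then ?w j (Suc (lookup (u - unit_vec i) j)) * lookup f (u - unit_vec i + unit_vec j) else 0)" for i j
    define T where "T i j = (if u + unit_vec j \<in> ?B \<and> 0 < lookup (u + unit_vec j) i
      then ?w j (Suc (lookup u j)) * lookup f (u + unit_vec j - unit_vec i) else 0)" for i j
    have EF: "lookup (E (F f)) u = (\<Sum>i<n. \<Sum>j<n. S i j)"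
      using True
      by (auto simp: E_def F_def S_def lookup_trunc lookup_lin_mult lookup_lower intro!: sum.cong)
    have "lookup (F (E f)) u = (\<Sum>j<n. \<Sum>i<n. T i j)"
      using True
      by (auto simp: E_def F_def T_def lookup_trunc lookup_lin_mult lookup_lower sum_distrib_left
          intro!: sum.cong)
    then have FE: "lookup (F (E f)) u = (\<Sum>i<n. \<Sum>j<n. T i j)"
      using sum.swap by metis
    have diag: "T i i = S i i + of_int (int (l i) + int (r i) - 1 - 2 * int (lookup u i)) * lookup f u"
      if "i < n" for i
    proof -
      have u: "l i \<le> lookup u i" "lookup u i < r i" using True that by (auto simp: box_def)
      have "S i i = ?w i (lookup u i) * lookup f u"
      proof (cases "l i < lookup u i")
        case l: True
        then have "u - unit_vec i \<in> ?B"
          using True by (auto simp: box_def lookup_minus lookup_single when_def)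
        then show ?thesis
          using l by (simp add: S_def minus_unit_vec_add lookup_minus)
      next
        \<comment> \<open>At the lower end of the string, either \<open>u - unit_vec i\<close>
          leaves the box or the exponent is zero; in both cases the guard makes \<open>S i i\<close>
          zero, in agreement with the weight.\<close>
        case False
        then have "u - unit_vec i \<notin> ?B \<or> lookup u i = 0"
          using u that by (auto simp: box_def lookup_minus dest!: spec[of _ i])
        then show ?thesis
          using False by (auto simp: S_def weight_def)
      qed
      moreover have "T i i = ?w i (Suc (lookup u i)) * lookup f u"
      proof (cases "Suc (lookup u i) < r i")
        case r: True
        then have "u + unit_vec i \<in> ?B"
          using True that by (auto simp: box_def lookup_add lookup_single when_def)
        then show ?thesis by (simp add: T_def lookup_add)
      next
        \<comment> \<open>At the upper end \<open>u + unit_vec i\<close> leaves the box, and the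
          weight at \<open>r i\<close> is zero as well.\<close>
        case False
        then have "weight (l i) (r i) (Suc (lookup u i)) = 0" by (simp add: weight_def)
        then show ?thesis by (simp add: T_def)
      qed
      moreover have "?w i (Suc (lookup u i)) = ?w i (lookup u i) + of_int (int (l i) + int (r i) - 1 - 2 * int (lookup u i))"
        using arg_cong[OF weight_diff[OF u], of "of_int :: int \<Rightarrow> 'k"] by simp
      ultimately show ?thesis by (simp add: algebra_simps)
    qed
    \<comment> \<open>The box is a product of intervals: if
      \<open>u - unit_vec i + unit_vec j\<close> lies in it, so do both intermediate monomials.
      Otherwise \<open>f\<close> has coefficient zero at that monomial.\<close>
    have off: "T i j = S i j" if "i < n" "j < n" "i \<noteq> j" for i j
    proof (cases "0 < lookup u i")
      case pos: True
      have eq: "u + unit_vec j - unit_vec i = u - unit_vec i + unit_vec j"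
        using pos \<open>i \<noteq> j\<close>
        by (auto intro!: poly_mapping_eqI simp: lookup_add lookup_minus lookup_single when_def)
      show ?thesis
      proof (cases "u - unit_vec i + unit_vec j \<in> ?B")
        case in_box: True
        have "l k \<le> lookup (u - unit_vec i) k \<and> lookup (u - unit_vec i) k < r k \<and>
            l k \<le> lookup (u + unit_vec j) k \<and> lookup (u + unit_vec j) k < r k" if "k < n" for k
          using in_box True that \<open>i \<noteq> j\<close> pos
          by (auto simp: box_def lookup_add lookup_minus lookup_single when_def
              dest!: spec[of _ k] split: if_splits)
        then have "u - unit_vec i \<in> ?B" "u + unit_vec j \<in> ?B"
          using True \<open>i < n\<close> \<open>j < n\<close> by (auto simp: box_def lookup_add lookup_minus lookup_single when_def)
        then show ?thesis
          using pos \<open>i \<noteq> j\<close> eq by (simp add: S_def T_def lookup_add lookup_minus lookup_single)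
      next
        case False
        then show ?thesis using f0' eq by (simp add: S_def T_def)
      qed
    next
      case False
      then show ?thesis using \<open>i \<noteq> j\<close> by (simp add: S_def T_def lookup_add lookup_single)
    qed
    have "(\<Sum>j<n. T i j) = (\<Sum>j<n. S i j) +
        of_int (int (l i) + int (r i) - 1 - 2 * int (lookup u i)) * lookup f u" if "i < n" for i
    proof -
      have "(\<Sum>j<n. T i j) = (\<Sum>j<n. S i j + (if j = i then
          of_int (int (l i) + int (r i) - 1 - 2 * int (lookup u i)) * lookup f u else 0))"
        using diag off that by (intro sum.cong) auto
      then show ?thesis using that by (simp add: sum.distrib)
    qed
    then have "lookup (F (E f)) u = lookup (E (F f)) u +
        (\<Sum>i<n. of_int (int (l i) + int (r i) - 1 - 2 * int (lookup u i))) * lookup f u"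
      unfolding EF FE by (simp add: sum.distrib sum_distrib_right)
    also have "(\<Sum>i<n. of_int (int (l i) + int (r i) - 1 - 2 * int (lookup u i)) :: 'k) =
        of_int (int c - 2 * int (mdeg u))"
    proof -
      have "(\<Sum>i<n. int (l i) + int (r i) - 1 - 2 * int (lookup u i)) =
          int (\<Sum>i<n. l i + r i) - int n - 2 * int (mdeg u)"
        unfolding mdeg_box[OF True] by (simp add: sum.distrib sum_subtractf sum_distrib_left)
      also have "\<dots> = int c - 2 * int (mdeg u)" unfolding c[symmetric] by simp
      finally show ?thesis by (metis of_int_sum)
    qed
    \<comment> \<open>\<open>f\<close> is homogeneous, so its coefficient at \<open>u\<close>
      vanishes unless \<open>mdeg u = d\<close>.\<close>
    also have "\<dots> * lookup f u = of_int (int c - 2 * int d) * lookup f u"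
      using f0[of u] by (cases "mdeg u = d") (auto simp: slice_def)
    finally show ?thesis by (simp add: lookup_add lookup_of_int_mult del: of_int_diff)
  qed
qed

text \<open>Truncating after each multiplication equals truncating once at the end. Multiplication
  preserves the lower bounds, so monomials leave the box only across an upper bound, and no multiple
  of them returns.\<close>

lemma trunc_box_pow:
  fixes f :: "'k::comm_ring_1 mpoly"
  assumes f: "keys f \<subseteq> box n l r"
  shows "((\<lambda>g. trunc (box n l r) (lin n * g)) ^^ s) f = trunc (box n l r) (lin n ^ s * f)"
proof -
  let ?B = "box n l r"
  let ?up = "{u. \<forall>i<n. l i \<le> lookup u i}"
  have up: "keys (lin n * g) \<subseteq> ?up" if g: "keys g \<subseteq> ?up" for g :: "'k mpoly"
  proof
    fix u assume "u \<in> keys (lin n * g)"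
    then have "(\<Sum>i<n. if 0 < lookup u i then lookup g (u - unit_vec i) else 0) \<noteq> 0"
      unfolding in_keys_iff lookup_lin_mult .
    then obtain i where "lookup g (u - unit_vec i) \<noteq> 0"
      by (metis (mono_tags, lifting) sum.neutral)
    then have "u - unit_vec i \<in> ?up" using g by (auto simp: in_keys_iff)
    then show "u \<in> ?up" by (auto simp: lookup_minus intro: le_trans[OF _ diff_le_self])
  qed
  have pow_up: "keys (lin n ^ s * f) \<subseteq> ?up" for s
  proof (induction s)
    case 0
    then show ?case using f by (auto simp: box_def)
  next
    case (Suc s)
    then show ?case using up[OF Suc] by (simp add: mult.assoc)
  qed
  have step: "trunc ?B (lin n * trunc ?B g) = trunc ?B (lin n * g)" if g: "keys g \<subseteq> ?up" for g :: "'k mpoly"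
  proof (rule poly_mapping_eqI)
    fix u
    have "lookup (trunc ?B g) (u - unit_vec i) = lookup g (u - unit_vec i)" if u: "u \<in> ?B" for i
    proof (cases "u - unit_vec i \<in> ?up")
      case True
      then have "u - unit_vec i \<in> ?B"
        using u by (auto simp: box_def lookup_minus less_imp_diff_less)
      then show ?thesis by (simp add: lookup_trunc)
    next
      case False
      then have "lookup g (u - unit_vec i) = 0" using g unfolding keys_subset_iff by blast
      then show ?thesis by (simp add: lookup_trunc)
    qed
    then show "lookup (trunc ?B (lin n * trunc ?B g)) u = lookup (trunc ?B (lin n * g)) u"
      by (auto simp: lookup_trunc lookup_lin_mult intro!: sum.cong)
  qed
  show ?thesis
  proof (induction s)
    case 0
    then show ?case using trunc_keys[OF f] by simp
  next
    case (Suc s)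
    then show ?case using step[OF pow_up] by (simp add: mult.assoc)
  qed
qed

text \<open>The graded pieces of the span of the box, with truncated multiplication by
  \<open>lin n\<close> as \<open>E\<close> and \<open>lower\<close> as \<open>F\<close>, satisfy the
  sl2 relation. Then \<open>E_pow_injective\<close> applies.\<close>

theorem lefschetz_on_box:
  assumes c: "c + n = (\<Sum>i<n. l i + r i)"
  shows "lefschetz_on TYPE('k::field_char_0) n (box n l r) c"
proof -
  let ?B = "box n l r"
  let ?V = "\<lambda>d. {f :: 'k mpoly. keys f \<subseteq> slice ?B d}"
  interpret graded_sl2 ?V "\<lambda>g. trunc ?B (lin n * g)" "lower n l r" c
  proof
    fix x y :: "'k mpoly" and d :: nat and k :: int
    show "x + y \<in> ?V d" if "x \<in> ?V d" "y \<in> ?V d"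
      using that by (auto simp: keys_subset_iff lookup_add)
    show "of_int k * x \<in> ?V d" if "x \<in> ?V d"
      using that by (auto simp: keys_subset_iff lookup_of_int_mult)
    show "trunc ?B (lin n * x) \<in> ?V (Suc d)" if "x \<in> ?V d"
    proof -
      have "lookup (trunc ?B (lin n * x)) u = 0" if u: "u \<notin> slice ?B (Suc d)" for u
      proof (cases "u \<in> ?B")
        case True
        then have "mdeg u \<noteq> Suc d" using u by (simp add: slice_def)
        then have "lookup x (u - unit_vec i) = 0" if "0 < lookup u i" for i
          using \<open>x \<in> ?V d\<close> mdeg_minus_unit_vec[OF that] by (auto simp: keys_subset_iff slice_def)
        then show ?thesis by (auto simp: lookup_trunc lookup_lin_mult intro!: sum.neutral)
      qed (simp add: lookup_trunc)
      then show ?thesis by (simp add: keys_subset_iff)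
    qed
    show "lower n l r x \<in> ?V d" if "x \<in> ?V (Suc d)"
    proof -
      have "lookup (lower n l r x) u = 0" if u: "u \<notin> slice ?B d" for u
      proof (cases "u \<in> ?B")
        case True
        then have "mdeg u \<noteq> d" using u by (simp add: slice_def)
        then have "lookup x (u + unit_vec i) = 0" for i
          using \<open>x \<in> ?V (Suc d)\<close> by (auto simp: keys_subset_iff slice_def mdeg_add mdeg_unit_vec)
        then show ?thesis by (simp add: lookup_lower)
      qed (simp add: lookup_lower)
      then show ?thesis by (simp add: keys_subset_iff)
    qed
    show "lower n l r x = 0" if "x \<in> ?V 0"
    proof -
      have "lookup x (u + unit_vec i) = 0" for u i
        using that by (auto simp: keys_subset_iff slice_def mdeg_add mdeg_unit_vec)
      then show ?thesis by (auto intro!: poly_mapping_eqI simp: lookup_lower)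
    qed
    show "trunc ?B (lin n * (x + y)) = trunc ?B (lin n * x) + trunc ?B (lin n * y)"
      by (simp add: distrib_left trunc_add)
    show "lower n l r (x + y) = lower n l r x + lower n l r y"
      by (auto intro!: poly_mapping_eqI simp: lookup_lower lookup_add distrib_left sum.distrib)
    show "lower n l r (trunc ?B (lin n * x)) = trunc ?B (lin n * lower n l r x) +
        of_int (int c - 2 * int d) * x" if "x \<in> ?V d"
      using lower_raise_commutator[OF _ c] that by blast
  qed
  show ?thesis
    unfolding lefschetz_on_def
  proof (intro allI impI)
    fix d s and f :: "'k mpoly"
    assume "keys f \<subseteq> slice ?B d" "s + 2 * d \<le> c" "trunc ?B (lin n ^ s * f) = 0"
    moreover have "keys f \<subseteq> ?B" using calculation(1) slice_subset by blast
    ultimately show "f = 0"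
      using E_pow_injective[of f d s] trunc_box_pow[of f n l r s] by simp
  qed
qed

text \<open>The span of \<open>M2\<close> is the submodule and that of \<open>M1\<close> the quotient of a short exact sequence.\<close>

lemma lefschetz_on_Un:
  assumes M1: "lefschetz_on TYPE('k::comm_ring_1) n M1 c" and M2: "lefschetz_on TYPE('k) n M2 c"
    and up: "\<And>m u. m \<in> M2 \<Longrightarrow> u \<in> M1 \<Longrightarrow> \<not> (\<forall>i. lookup m i \<le> lookup u i)"
  shows "lefschetz_on TYPE('k) n (M1 \<union> M2) c"
  unfolding lefschetz_on_def
proof (intro allI impI)
  fix d s and f :: "'k mpoly"
  assume f: "keys f \<subseteq> slice (M1 \<union> M2) d" and s: "s + 2 * d \<le> c"
    and zero: "trunc (M1 \<union> M2) (lin n ^ s * f) = 0"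
  \<comment> \<open>No monomial of \<open>M1\<close> is a multiple of one of \<open>M2\<close>, so
    the span of \<open>M2\<close> maps to zero in the quotient.\<close>
  have keys_up: "trunc M1 (lin n ^ s * g) = 0" if g: "keys g \<subseteq> M2" for g :: "'k mpoly"
  proof -
    have "u \<notin> M1" if u: "u \<in> keys (lin n ^ s * g)" for u
    proof -
      obtain x m where "m \<in> keys g" "u = x + m"
        using keys_mult[of "lin n ^ s" g] u by blast
      then show ?thesis using up[of m u] g by (auto simp: lookup_add)
    qed
    then show ?thesis by (auto simp: trunc_eq_0_iff in_keys_iff)
  qed
  have split: "f = trunc M1 f + trunc (M2 - M1) f"
    using f by (auto intro!: poly_mapping_eqI simp: keys_subset_iff lookup_add lookup_trunc slice_def)
  have "trunc M1 (lin n ^ s * f) = trunc M1 (lin n ^ s * trunc M1 f)"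
    using keys_up[of "trunc (M2 - M1) f"]
    by (subst split) (auto simp: distrib_left trunc_add keys_trunc)
  moreover have "trunc M1 (lin n ^ s * f) = 0" "trunc M2 (lin n ^ s * f) = 0"
    using zero by (auto simp: trunc_eq_0_iff)
  moreover have "keys (trunc M1 f) \<subseteq> slice M1 d"
    using f by (auto simp: keys_trunc slice_def)
  \<comment> \<open>Injectivity on the quotient first forces \<open>f\<close> into the submodule,
    where injectivity applies a second time.\<close>
  ultimately have "trunc M1 f = 0"
    using M1 s unfolding lefschetz_on_def by metis
  then have "keys f \<subseteq> slice M2 d"
    using f by (auto simp: trunc_eq_0_iff slice_def in_keys_iff)
  then show "f = 0"
    using M2 s \<open>trunc M2 (lin n ^ s * f) = 0\<close> unfolding lefschetz_on_def by metis
qed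

section \<open>Symmetric sets of monomials\<close>

text \<open>The bound on \<open>mdeg m\<close> ensures that the subtraction \<open>c - d\<close> is
  a true reflection on all degrees that occur.\<close>

definition symmetric_about :: "(nat \<Rightarrow>\<^sub>0 nat) set \<Rightarrow> nat \<Rightarrow> bool" where
  "symmetric_about M c \<longleftrightarrow>
     (\<forall>m\<in>M. mdeg m \<le> c) \<and> (\<forall>d\<le>c. card (slice M d) = card (slice M (c - d)))"

definition expo :: "nat \<Rightarrow> (nat \<Rightarrow> nat) \<Rightarrow> nat \<Rightarrow>\<^sub>0 nat" where
  "expo n e = (\<Sum>j<n. Poly_Mapping.single j (e j))"

lemma lookup_expo: "lookup (expo n e) i = (if i < n then e i else 0)"
  by (simp add: expo_def lookup_sum lookup_single when_def)

lemma mdeg_expo: "mdeg (expo n e) = (\<Sum>i<n. e i)"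
  by (subst mdeg_lt[of n]) (simp_all add: lookup_expo)

text \<open>Reflecting every exponent within its interval, \<open>x\<close> to
  \<open>l i + r i - 1 - x\<close>, maps the box to itself injectively and sends degree
  \<open>d\<close> to \<open>c - d\<close>. The resulting inequality of cardinalities, used for
  \<open>d\<close> and for \<open>c - d\<close>, gives equality.\<close>

lemma symmetric_about_box:
  assumes c: "c + n = (\<Sum>i<n. l i + r i)"
  shows "symmetric_about (box n l r) c"
proof -
  define rho where "rho u = expo n (\<lambda>i. l i + r i - 1 - lookup u i)" for u
  have rho: "rho u \<in> box n l r" "mdeg u + mdeg (rho u) = c" if u: "u \<in> box n l r" for u
  proof -
    show "rho u \<in> box n l r"
      unfolding box_def mem_Collect_eq
    proof (intro conjI allI impI)
      fix i assume i: "i < n"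
      then have "l i \<le> lookup u i" "lookup u i < r i" using u by (auto simp: box_def)
      then show "l i \<le> lookup (rho u) i" "lookup (rho u) i < r i"
        using i unfolding rho_def lookup_expo by auto
    qed (simp add: rho_def lookup_expo)
    have "mdeg u + mdeg (rho u) + n = (\<Sum>i<n. lookup u i + (l i + r i - 1 - lookup u i) + 1)"
      unfolding mdeg_box[OF u] rho_def mdeg_expo by (simp only: sum.distrib) simp
    also have "\<dots> = (\<Sum>i<n. l i + r i)"
      using u by (intro sum.cong) (auto simp: box_def)
    finally show "mdeg u + mdeg (rho u) = c" using c by simp
  qed
  have inj: "inj_on rho (box n l r)"
  proof (rule inj_onI, rule poly_mapping_eqI)
    fix u v i assume uv: "u \<in> box n l r" "v \<in> box n l r" "rho u = rho v"
    show "lookup u i = lookup v i"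
    proof (cases "i < n")
      case True
      then have "l i + r i - 1 - lookup u i = l i + r i - 1 - lookup v i"
        using arg_cong[OF uv(3), of "\<lambda>w. lookup w i"] by (simp add: rho_def lookup_expo)
      moreover have "lookup u i < r i" "lookup v i < r i"
        using uv True by (auto simp: box_def)
      ultimately show ?thesis by linarith
    qed (use uv in \<open>auto simp: box_def\<close>)
  qed
  have le: "card (slice (box n l r) d) \<le> card (slice (box n l r) (c - d))" for d
  proof (rule card_inj_on_le)
    show "inj_on rho (slice (box n l r) d)"
      by (rule inj_on_subset[OF inj slice_subset])
    show "rho ` slice (box n l r) d \<subseteq> slice (box n l r) (c - d)"
    proof (rule image_subsetI)
      fix u assume "u \<in> slice (box n l r) d"
      then show "rho u \<in> slice (box n l r) (c - d)"
        using rho[of u] by (simp add: slice_def)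
    qed
    show "finite (slice (box n l r) (c - d))"
      by (rule finite_subset[OF slice_subset finite_box])
  qed
  show ?thesis
    unfolding symmetric_about_def
  proof (intro conjI ballI allI impI)
    fix u assume "u \<in> box n l r"
    then show "mdeg u \<le> c" using rho(2)[of u] by linarith
  next
    fix d assume "d \<le> c"
    then show "card (slice (box n l r) d) = card (slice (box n l r) (c - d))"
      using le[of d] le[of "c - d"] by simp
  qed
qed

lemma symmetric_about_Un_cancel:
  assumes "symmetric_about (M1 \<union> M2) c" "symmetric_about M1 c"
    and "finite (M1 \<union> M2)" "M1 \<inter> M2 = {}"
  shows "symmetric_about M2 c"
proof -
  have card: "card (slice (M1 \<union> M2) d) = card (slice M1 d) + card (slice M2 d)" for d
  proof -
    have "slice (M1 \<union> M2) d = slice M1 d \<union> slice M2 d" by (auto simp: slice_def)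
    moreover have "finite (slice M1 d)" "finite (slice M2 d)"
      using assms(3) by (auto intro: finite_subset[OF slice_subset])
    moreover have "slice M1 d \<inter> slice M2 d = {}" using assms(4) by (auto simp: slice_def)
    ultimately show ?thesis by (simp add: card_Un_disjoint)
  qed
  have "card (slice M2 d) = card (slice M2 (c - d))" if "d \<le> c" for d
  proof -
    have "card (slice (M1 \<union> M2) d) = card (slice (M1 \<union> M2) (c - d))" "card (slice M1 d) = card (slice M1 (c - d))"
      using assms(1,2) that unfolding symmetric_about_def by blast+
    then show ?thesis by (simp add: card)
  qed
  then show ?thesis using assms(1) unfolding symmetric_about_def by blast
qed

text \<open>For \<open>S = {..<n}\<close> these are the standard monomials of the quotient ring; in general they are a
  basis of its ideal generated by the product of the \<open>x_i ^ p_i\<close> with \<open>i \<notin> S\<close>.\<close>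

definition std_monomials :: "nat \<Rightarrow> (nat \<Rightarrow> nat) \<Rightarrow> (nat \<Rightarrow> nat) \<Rightarrow> nat set \<Rightarrow> (nat \<Rightarrow>\<^sub>0 nat) set" where
  "std_monomials n a p S = {u. (\<forall>i<n. lookup u i < a i) \<and> (\<forall>i\<ge>n. lookup u i = 0) \<and>
     (\<forall>i<n. i \<notin> S \<longrightarrow> p i \<le> lookup u i) \<and> (\<exists>i\<in>S. lookup u i < p i)}"

lemma std_monomials_subset_box: "std_monomials n a p S \<subseteq> box n (\<lambda>_. 0) a"
  by (auto simp: std_monomials_def box_def)

lemma finite_std_monomials: "finite (std_monomials n a p S)"
  by (rule finite_subset[OF std_monomials_subset_box finite_box])

text \<open>Induction on \<open>S\<close>: a box is split off as the quotient, and the submodule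
  left over is the same kind of set for \<open>S - {j}\<close>. What has to be shown is that the box
  is centred at \<open>c / 2\<close>, so that symmetry passes to the remainder.\<close>

lemma lefschetz_on_std_monomials:
  assumes pa: "\<forall>i<n. p i < a i" and S: "S \<subseteq> {..<n}"
    and sym: "symmetric_about (std_monomials n a p S) c"
  shows "lefschetz_on TYPE('k::field_char_0) n (std_monomials n a p S) c"
proof -
  have "finite S" using S finite_subset by blast
  then show ?thesis using S sym
  proof (induction S rule: finite_psubset_induct)
    case (psubset S)
    let ?M = "std_monomials n a p S"
    show ?case
    proof (cases "\<exists>j\<in>S. 0 < p j")
      case False
      then have "?M = {}" by (auto simp: std_monomials_def)
      then show ?thesis by (simp add: lefschetz_on_def slice_def)
    next
      case True
      then obtain j where j: "j \<in> S" "0 < p j"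
        and j_min: "\<And>i. i \<in> S \<Longrightarrow> 0 < p i \<Longrightarrow> a j - p j \<le> a i - p i"
        using ex_has_least_nat[of "\<lambda>i. i \<in> S \<and> 0 < p i" _ "\<lambda>i. a i - p i"] by blast
      have jn: "j < n" using j psubset.prems by auto
      \<comment> \<open>The box is the layer of \<open>?M\<close> in which the exponent at
        \<open>j\<close> is below \<open>p j\<close>. Indices outside \<open>S\<close> keep their
        lower bound \<open>p i\<close>, and \<open>j\<close> itself witnesses the existential
        condition.\<close>
      define l where "l i = (if i \<in> S then 0 else p i)" for i
      define r where "r = a(j := p j)"
      let ?M' = "std_monomials n a p (S - {j})"
      have M_eq: "?M = box n l r \<union> ?M'"
      proof (intro set_eqI iffI)
        fix u assume u: "u \<in> ?M"
        then obtain i where i: "i \<in> S" "lookup u i < p i" by (auto simp: std_monomials_def)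
        show "u \<in> box n l r \<union> ?M'"
        proof (cases "lookup u j < p j")
          case True
          then have "u \<in> box n l r"
            using u by (auto simp: std_monomials_def box_def l_def r_def)
          then show ?thesis ..
        next
          case False
          then have "i \<in> S - {j}" using i by auto
          then have "u \<in> ?M'"
            using u i False by (auto simp: std_monomials_def)
          then show ?thesis ..
        qed
      next
        fix u assume "u \<in> box n l r \<union> ?M'"
        then show "u \<in> ?M"
        proof
          assume u: "u \<in> box n l r"
          have "lookup u i < a i" if "i < n" for i
            using u that pa by (cases "i = j") (auto simp: box_def r_def dest!: spec[of _ i])
          moreover have "lookup u j < p j" using u jn by (auto simp: box_def r_def dest!: spec[of _ j])
          moreover have "p i \<le> lookup u i" if "i < n" "i \<notin> S" for i
            using u that by (auto simp: box_def l_def)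
          ultimately show ?thesis using j u by (auto simp: std_monomials_def box_def)
        next
          assume "u \<in> ?M'"
          then show ?thesis by (auto simp: std_monomials_def)
        qed
      qed
      have M'_ge: "p j \<le> lookup u j" if "u \<in> ?M'" for u
        using that jn by (auto simp: std_monomials_def)
      have box_lt: "lookup u j < p j" if "u \<in> box n l r" for u
        using that jn by (auto simp: box_def r_def dest!: spec[of _ j])
      have lr: "l i < r i" if "i < n" for i
        using that pa j by (auto simp: l_def r_def)
      have sum_a: "(\<Sum>k<n. (a(i := p i)) k) + (a i - p i) = (\<Sum>k<n. a k)" if "i < n" for i
        using that pa[rule_format, OF that] by (simp add: sum.remove[of "{..<n}" i])
      define bot where "bot = (\<Sum>i<n. l i)"
      define top where "top = (\<Sum>i<n. r i - 1)"
      have top: "top + n = (\<Sum>i<n. r i)"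
      proof -
        have "top + n = (\<Sum>i<n. r i - 1 + 1)" unfolding top_def by (simp only: sum.distrib) simp
        also have "\<dots> = (\<Sum>i<n. r i)" using lr by (intro sum.cong refl) (metis One_nat_def Suc_eq_plus1 Suc_pred gr_zeroI not_less_zero lessThan_iff)
        finally show ?thesis .
      qed
      have bounds: "bot \<le> mdeg u \<and> mdeg u \<le> top" if u: "u \<in> ?M" for u
      proof
        have mdeg_u: "mdeg u = (\<Sum>i<n. lookup u i)"
          using u std_monomials_subset_box mdeg_box by blast
        show "bot \<le> mdeg u"
          unfolding mdeg_u bot_def using u by (intro sum_mono) (auto simp: std_monomials_def l_def)
        obtain i where i: "i \<in> S" "lookup u i < p i" using u by (auto simp: std_monomials_def)
        then have "i < n" using psubset.prems by auto
        have "mdeg u + n = (\<Sum>k<n. lookup u k + 1)"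
          unfolding mdeg_u by (simp only: sum.distrib) simp
        also have "\<dots> \<le> (\<Sum>k<n. (a(i := p i)) k)"
          using u i by (intro sum_mono) (auto simp: std_monomials_def Suc_le_eq)
        \<comment> \<open>Minimality of \<open>a j - p j\<close> enters here: lowering the bound at
          \<open>j\<close> to \<open>p j\<close> costs no more than doing so at
          \<open>i\<close>.\<close>
        also have "\<dots> \<le> (\<Sum>i<n. r i)"
          using sum_a[OF \<open>i < n\<close>] sum_a[OF jn] j_min[OF i(1)] i(2) unfolding r_def by linarith
        finally show "mdeg u \<le> top" using top by simp
      qed
      \<comment> \<open>The two extreme corners of the box attain the bounds, so \<open>bot\<close>
        and \<open>top\<close> are the lowest and highest degrees of all of
        \<open>?M\<close>.\<close>
      have "expo n l \<in> ?M" "expo n (\<lambda>i. r i - 1) \<in> ?M"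
      proof -
        have "l i \<le> r i - 1" "r i - 1 < r i" if "i < n" for i using lr[OF that] by simp_all
        then have "expo n l \<in> box n l r" "expo n (\<lambda>i. r i - 1) \<in> box n l r"
          using lr by (simp_all add: box_def lookup_expo)
        then show "expo n l \<in> ?M" "expo n (\<lambda>i. r i - 1) \<in> ?M" unfolding M_eq by simp_all
      qed
      then have slices: "expo n l \<in> slice ?M bot" "expo n (\<lambda>i. r i - 1) \<in> slice ?M top"
        by (simp_all add: slice_def mdeg_expo bot_def top_def)
      then have ne: "slice ?M bot \<noteq> {}" "slice ?M top \<noteq> {}" by blast+
      have le_c: "bot \<le> c" "top \<le> c"
        using slices psubset.prems(2) by (auto simp: slice_def symmetric_about_def)
      have nonempty_refl: "slice ?M (c - d) \<noteq> {}" if "slice ?M d \<noteq> {}" "d \<le> c" for d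
      proof -
        have fin: "finite (slice ?M d')" for d'
          using finite_std_monomials slice_subset by (rule rev_finite_subset)
        have "card (slice ?M d) = card (slice ?M (c - d))"
          using psubset.prems(2) that(2) unfolding symmetric_about_def by blast
        then show ?thesis using that(1) fin by (metis card_eq_0_iff)
      qed
      \<comment> \<open>Symmetry makes the slices in degrees \<open>c - bot\<close> and
        \<open>c - top\<close> nonempty, so both degrees lie between \<open>bot\<close> and
        \<open>top\<close>. This forces \<open>c = bot + top\<close>, which is twice the centre of
        the box.\<close>
      have "c - bot \<le> top" "bot \<le> c - top"
        using nonempty_refl[OF ne(1) le_c(1)] nonempty_refl[OF ne(2) le_c(2)] by (auto simp: slice_def dest!: bounds)
      then have "c + n = (\<Sum>i<n. l i + r i)"
        using le_c top by (simp add: sum.distrib bot_def)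
      note box = lefschetz_on_box[OF this, where 'k = 'k] symmetric_about_box[OF this]
      have "symmetric_about ?M' c"
      proof (rule symmetric_about_Un_cancel[OF _ box(2)])
        show "symmetric_about (box n l r \<union> ?M') c" using psubset.prems M_eq by simp
        show "finite (box n l r \<union> ?M')" using M_eq finite_std_monomials by metis
        show "box n l r \<inter> ?M' = {}" using M'_ge box_lt leD by blast
      qed
      then have "lefschetz_on TYPE('k) n ?M' c"
        using psubset.IH[of "S - {j}"] psubset.prems(1) j(1) by blast
      then show ?thesis
        unfolding M_eq
      proof (rule lefschetz_on_Un[OF box(1)])
        fix m u assume "m \<in> ?M'" "u \<in> box n l r"
        then show "\<not> (\<forall>i. lookup m i \<le> lookup u i)"
          using M'_ge[of m] box_lt[of u] by (metis leD le_trans)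
      qed
    qed
  qed
qed

section \<open>Dimensions of spaces spanned by monomials\<close>

definition monomials :: "nat \<Rightarrow> nat \<Rightarrow> (nat \<Rightarrow>\<^sub>0 nat) set" where
  "monomials n d = {m. keys m \<subseteq> {..<n} \<and> mdeg m = d}"

lemma finite_monomials: "finite (monomials n d)"
proof (rule finite_subset[OF _ finite_box[of n "\<lambda>_. 0" "\<lambda>_. Suc d"]])
  show "monomials n d \<subseteq> box n (\<lambda>_. 0) (\<lambda>_. Suc d)"
  proof
    fix m assume m: "m \<in> monomials n d"
    then have "mdeg m = (\<Sum>i<n. lookup m i)" by (intro mdeg_superset) (auto simp: monomials_def)
    then have "lookup m i \<le> d" if "i < n" for i
      using m that member_le_sum[of i "{..<n}" "lookup m"] by (auto simp: monomials_def)
    moreover have "lookup m i = 0" if "n \<le> i" for i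
      using m that by (auto simp: monomials_def keys_subset_iff)
    ultimately show "m \<in> box n (\<lambda>_. 0) (\<lambda>_. Suc d)" by (auto simp: box_def le_imp_less_Suc)
  qed
qed

lemma hom_comp_eq: "hom_comp n d = {f. keys f \<subseteq> monomials n d}"
  by (auto simp: hom_comp_def polyring_def monomials_def)

lemma hom_comp_polyring: "f \<in> hom_comp n d \<Longrightarrow> f \<in> polyring n"
  by (simp add: hom_comp_def)

lemma lookup_pscale: "lookup (pscale x f) m = x * lookup f m"
  by (simp add: pscale_def lookup_const_mult)

interpretation pscale: vector_space "pscale :: 'k::field \<Rightarrow> 'k mpoly \<Rightarrow> 'k mpoly"
  by standard (auto intro!: poly_mapping_eqI simp: lookup_pscale lookup_add algebra_simps)

abbreviation mono1 :: "(nat \<Rightarrow>\<^sub>0 nat) \<Rightarrow> 'k::field mpoly" where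
  "mono1 m \<equiv> Poly_Mapping.single m 1"

lemma inj_mono1: "inj_on (mono1 :: _ \<Rightarrow> 'k::field mpoly) K"
  by (rule inj_onI) (metis keys_single singleton_inject zero_neq_one)

lemma lookup_sum_pscale_mono1:
  assumes "finite K"
  shows "lookup (\<Sum>m\<in>K. pscale (x m) (mono1 m)) u = (if u \<in> K then x u else 0)"
proof -
  have "lookup (\<Sum>m\<in>K. pscale (x m) (mono1 m)) u = (\<Sum>m\<in>K. if m = u then x u else 0)"
    unfolding lookup_sum by (intro sum.cong) (auto simp: lookup_pscale lookup_single when_def)
  then show ?thesis using assms by simp
qed

lemma independent_monomials:
  assumes "finite K"
  shows "pscale.independent ((mono1 :: _ \<Rightarrow> 'k::field mpoly) ` K)"
proof (rule pscale.independent_if_scalars_zero)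
  show "finite ((mono1 :: _ \<Rightarrow> 'k mpoly) ` K)" using assms by simp
  fix x :: "'k mpoly \<Rightarrow> 'k" and f :: "'k mpoly"
  assume sum: "(\<Sum>f\<in>mono1 ` K. pscale (x f) f) = 0" and "f \<in> mono1 ` K"
  then obtain m where m: "m \<in> K" "f = mono1 m" by blast
  have "(\<Sum>m\<in>K. pscale (x (mono1 m)) (mono1 m)) = 0"
    using sum by (simp add: sum.reindex[OF inj_mono1])
  from arg_cong[OF this, of "\<lambda>f. lookup f m"] show "x f = 0"
    using m assms by (simp add: lookup_sum_pscale_mono1[where x = "\<lambda>m. x (mono1 m)"])
qed

lemma span_monomials:
  assumes "finite K"
  shows "pscale.span ((mono1 :: _ \<Rightarrow> 'k::field mpoly) ` K) = {f. keys f \<subseteq> K}"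
proof (rule pscale.span_subspace)
  show "mono1 ` K \<subseteq> {f :: 'k mpoly. keys f \<subseteq> K}" by auto
  show "pscale.subspace {f :: 'k mpoly. keys f \<subseteq> K}"
    by (rule pscale.subspaceI) (auto simp: keys_subset_iff lookup_add lookup_pscale)
  show "{f :: 'k mpoly. keys f \<subseteq> K} \<subseteq> pscale.span (mono1 ` K)"
  proof
    fix f :: "'k mpoly" assume "f \<in> {f. keys f \<subseteq> K}"
    then have "f = (\<Sum>m\<in>K. pscale (lookup f m) (mono1 m))"
      using assms by (auto intro!: poly_mapping_eqI simp: lookup_sum_pscale_mono1 keys_subset_iff)
    also have "\<dots> \<in> pscale.span (mono1 ` K)"
      by (intro pscale.span_sum pscale.span_scale pscale.span_base) auto
    finally show "f \<in> pscale.span (mono1 ` K)" .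
  qed
qed

lemma card_mono1_image: "card ((mono1 :: _ \<Rightarrow> 'k::field mpoly) ` K) = card K"
  by (rule card_image[OF inj_mono1])

lemma dim_keys_subset:
  assumes "finite K"
  shows "pscale.dim {f :: 'k::field mpoly. keys f \<subseteq> K} = card K"
  using pscale.dim_span_eq_card_independent[OF independent_monomials[where 'k = 'k, OF assms]]
  unfolding span_monomials[OF assms] card_mono1_image .

text \<open>A vector of \<open>span T\<close> outside \<open>span S\<close> would extend
  \<open>S\<close> to an independent set larger than the spanning set \<open>T\<close>. The ambient
  space may have infinite dimension.\<close>

lemma (in vector_space) span_eq_if_independent_card:
  assumes S: "independent S" "S \<subseteq> span T" and T: "finite T" "card S = card T"
  shows "span S = span T"
proof
  show "span S \<subseteq> span T" using S(2) by (simp add: span_minimal)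
  show "span T \<subseteq> span S"
  proof (rule ccontr)
    assume "\<not> span T \<subseteq> span S"
    then obtain x where x: "x \<in> span T" "x \<notin> span S" by blast
    have "finite S" using independent_span_bound[OF T(1) S] by blast
    then have "card (insert x S) = Suc (card T)"
      using x(2) span_base T(2) by (metis card_insert_disjoint)
    moreover have "card (insert x S) \<le> card T"
      using independent_span_bound[OF T(1) independent_insertI[OF x(2) S(1)]] x(1) S(2) by blast
    ultimately show False by simp
  qed
qed

section \<open>The quotient ring\<close>

lemma lin_mult_hom_comp:
  assumes f: "f \<in> hom_comp n d"
  shows "lin n * f \<in> hom_comp n (Suc d)"
proof -
  have "u \<in> monomials n (Suc d)" if u: "u \<in> keys (lin n * f)" for u
  proof -
    obtain i where i: "i < n" "0 < lookup u i" "u - unit_vec i \<in> keys f"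
    proof -
      have "(\<Sum>i<n. if 0 < lookup u i then lookup f (u - unit_vec i) else 0) \<noteq> 0"
        using u unfolding in_keys_iff lookup_lin_mult .
      then obtain i where "i \<in> {..<n}" "(if 0 < lookup u i then lookup f (u - unit_vec i) else 0) \<noteq> 0"
        by (rule sum.not_neutral_contains_not_neutral)
      then show ?thesis using that by (auto simp: in_keys_iff split: if_splits)
    qed
    then have "keys (u - unit_vec i) \<subseteq> {..<n}" "mdeg (u - unit_vec i) = d"
      using f by (auto simp: hom_comp_eq monomials_def)
    moreover have "keys u \<subseteq> keys (u - unit_vec i) \<union> {i}"
      by (auto simp: in_keys_iff lookup_minus lookup_single when_def split: if_splits)
    ultimately show ?thesis
      using i mdeg_minus_unit_vec[OF i(2)] by (auto simp: monomials_def)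
  qed
  then show ?thesis by (auto simp: hom_comp_eq)
qed

lemma lin_pow_mult_hom_comp: "f \<in> hom_comp n d \<Longrightarrow> lin n ^ s * f \<in> hom_comp n (d + s)"
  by (induction s) (auto simp: mult.assoc dest: lin_mult_hom_comp)

lemma lin_hom_comp: "lin n \<in> hom_comp n 1"
proof -
  have "1 \<in> hom_comp n 0" by (simp add: hom_comp_def polyring_def mdeg_def)
  from lin_mult_hom_comp[OF this] show ?thesis by simp
qed

section \<open>The monomial ideal and its standard monomials\<close>

lemma xmon_eq: "xmon n e = Poly_Mapping.single (expo n e) 1"
  by (simp add: xmon_def expo_def)

definition gen_expo :: "nat \<Rightarrow> (nat \<Rightarrow> nat) \<Rightarrow> (nat \<Rightarrow> nat) \<Rightarrow> nat \<Rightarrow> nat \<Rightarrow>\<^sub>0 nat" where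
  "gen_expo n a p j = expo n (if j < n then (\<lambda>_. 0)(j := a j) else p)"

lemma gens_eq: "gens n a p j = Poly_Mapping.single (gen_expo n a p j) 1"
  by (simp add: gens_def gen_expo_def xmon_eq)

lemma lookup_gen_expo_le_iff:
  "(\<forall>i. lookup (gen_expo n a p j) i \<le> lookup m i) \<longleftrightarrow>
    (if j < n then a j \<le> lookup m j else \<forall>i<n. p i \<le> lookup m i)"
  by (auto simp: gen_expo_def lookup_expo)

text \<open>The bounds \<open>a i\<close> exclude divisibility by the pure powers, and the
  existential condition excludes the remaining generator, which carries the index
  \<open>n\<close>.\<close>

lemma std_monomials_iff:
  assumes "keys m \<subseteq> {..<n}"
  shows "m \<in> std_monomials n a p {..<n} \<longleftrightarrow>
    \<not> (\<exists>j\<le>n. \<forall>i. lookup (gen_expo n a p j) i \<le> lookup m i)"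
proof -
  let ?le = "\<lambda>j. \<forall>i. lookup (gen_expo n a p j) i \<le> lookup m i"
  have "(\<exists>j\<le>n. ?le j) \<longleftrightarrow> (\<exists>j<n. ?le j) \<or> ?le n"
    using le_less by metis
  also have "(\<exists>j<n. ?le j) \<longleftrightarrow> (\<exists>j<n. a j \<le> lookup m j)"
    unfolding lookup_gen_expo_le_iff by meson
  also have "?le n \<longleftrightarrow> (\<forall>i<n. p i \<le> lookup m i)"
    unfolding lookup_gen_expo_le_iff by simp
  finally have gen: "(\<exists>j\<le>n. ?le j) \<longleftrightarrow> (\<exists>j<n. a j \<le> lookup m j) \<or> (\<forall>i<n. p i \<le> lookup m i)" .
  have "lookup m i = 0" if "n \<le> i" for i using assms that by (auto simp: keys_subset_iff)
  then show ?thesis unfolding gen std_monomials_def by (auto simp: not_le)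
qed

lemma std_monomials_keys: "m \<in> std_monomials n a p S \<Longrightarrow> keys m \<subseteq> {..<n}"
  by (auto simp: std_monomials_def keys_subset_iff)

lemma zero_in_ideal: "0 \<in> the_ideal n a p"
  unfolding the_ideal_def by (auto intro!: exI[of _ "\<lambda>_. 0"] simp: polyring_def)

lemma add_in_ideal:
  assumes "f \<in> the_ideal n a p" "g \<in> the_ideal n a p"
  shows "f + g \<in> the_ideal n a p"
proof -
  obtain h h' where "\<forall>j\<le>n. h j \<in> polyring n" "f = (\<Sum>j\<le>n. h j * gens n a p j)"
    "\<forall>j\<le>n. h' j \<in> polyring n" "g = (\<Sum>j\<le>n. h' j * gens n a p j)"
    using assms by (auto simp: the_ideal_def)
  moreover have "x + y \<in> polyring n" if "x \<in> polyring n" "y \<in> polyring n" for x y :: "'a mpoly"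
    using that Poly_Mapping.keys_add[of x y] by (auto simp: polyring_def)
  ultimately show ?thesis
    unfolding the_ideal_def
    by (auto intro!: exI[of _ "\<lambda>j. h j + h' j"] simp: distrib_right sum.distrib)
qed

lemma monomial_in_ideal:
  fixes x :: "'k::comm_ring_1"
  assumes m: "keys m \<subseteq> {..<n}" "m \<notin> std_monomials n a p {..<n}"
  shows "Poly_Mapping.single m x \<in> the_ideal n a p"
proof -
  obtain j where j: "j \<le> n" "\<forall>i. lookup (gen_expo n a p j) i \<le> lookup m i"
    using m(2) std_monomials_iff[OF m(1), of a p] by blast
  define t where "t = gen_expo n a p j"
  define h :: "nat \<Rightarrow> 'k mpoly" where "h j' = (if j' = j then Poly_Mapping.single (m - t) x else 0)" for j'
  have "t + (m - t) = m" using j(2) add_eq_iff_minus[of t "m - t" m] by (simp add: t_def)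
  then have "h j * gens n a p j = Poly_Mapping.single m x"
    by (simp add: h_def gens_eq mult_single t_def add.commute)
  moreover have "(\<Sum>j'\<le>n. h j' * gens n a p j') = (\<Sum>j'\<le>n. if j' = j then h j * gens n a p j else 0)"
    by (intro sum.cong) (auto simp: h_def)
  ultimately have "Poly_Mapping.single m x = (\<Sum>j'\<le>n. h j' * gens n a p j')"
    using j(1) by simp
  moreover have "keys (m - t) \<subseteq> {..<n}"
    using m(1) by (auto simp: in_keys_iff lookup_minus subset_iff)
  then have "\<forall>j'\<le>n. h j' \<in> polyring n" by (auto simp: h_def polyring_def)
  ultimately show ?thesis unfolding the_ideal_def by blast
qed

text \<open>Membership in a monomial ideal is decided term by term: each term of a multiple of a
  generator is divisible by it, and conversely \<open>f\<close> is the sum of its terms, each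
  divisible by a generator.\<close>

lemma in_ideal_iff:
  fixes f :: "'k::comm_ring_1 mpoly"
  assumes f: "f \<in> polyring n"
  shows "f \<in> the_ideal n a p \<longleftrightarrow> trunc (std_monomials n a p {..<n}) f = 0"
proof
  assume "f \<in> the_ideal n a p"
  then obtain h where h: "f = (\<Sum>j\<le>n. h j * gens n a p j)" by (auto simp: the_ideal_def)
  have "lookup f m = 0" if m: "m \<in> std_monomials n a p {..<n}" for m
  proof -
    have "lookup (h j * gens n a p j) m = 0" if "j \<le> n" for j
      using that m std_monomials_iff[OF std_monomials_keys[OF m]]
      unfolding gens_eq mult.commute[of "h j"] lookup_single_mult by auto
    then show ?thesis unfolding h lookup_sum by simp
  qed
  then show "trunc (std_monomials n a p {..<n}) f = 0" by (simp add: trunc_eq_0_iff)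
next
  assume trunc: "trunc (std_monomials n a p {..<n}) f = 0"
  have "(\<Sum>m\<in>K. Poly_Mapping.single m (lookup f m)) \<in> the_ideal n a p"
    if "finite K" "K \<subseteq> keys f" for K
    using that
  proof (induction K rule: finite_induct)
    case empty
    then show ?case by (simp add: zero_in_ideal)
  next
    case (insert m K)
    then have "lookup f m \<noteq> 0" by (auto simp: in_keys_iff)
    then have "m \<notin> std_monomials n a p {..<n}" using trunc by (auto simp: trunc_eq_0_iff)
    moreover have "keys m \<subseteq> {..<n}" using insert.prems f by (auto simp: polyring_def)
    ultimately show ?case using insert by (simp add: add_in_ideal monomial_in_ideal)
  qed
  from this[of "keys f"] show "f \<in> the_ideal n a p"
    using sum_single_keys[of "keys f" f] by simp
qed

text \<open>The ideal in degree \<open>d\<close> is spanned by the nonstandard monomials of that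
  degree, so the difference of dimensions counts the standard ones.\<close>

lemma hilb_eq: "hilb n a p TYPE('k::field) d = card (slice (std_monomials n a p {..<n}) d)"
proof -
  let ?M = "std_monomials n a p {..<n}"
  have "hom_comp n d \<inter> the_ideal n a p = {f :: 'k mpoly. keys f \<subseteq> monomials n d - ?M}"
  proof (rule set_eqI)
    fix f :: "'k mpoly"
    have "f \<in> hom_comp n d \<inter> the_ideal n a p \<longleftrightarrow> keys f \<subseteq> monomials n d \<and> trunc ?M f = 0"
      using in_ideal_iff[OF hom_comp_polyring, of f n d] by (auto simp: hom_comp_eq)
    then show "f \<in> hom_comp n d \<inter> the_ideal n a p \<longleftrightarrow> f \<in> {f. keys f \<subseteq> monomials n d - ?M}"
      by (auto simp: trunc_eq_0_iff in_keys_iff)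
  qed
  then have "hilb n a p TYPE('k) d = card (monomials n d) - card (monomials n d - ?M)"
    using dim_keys_subset[OF finite_monomials, where 'k = 'k, of n d]
      dim_keys_subset[of "monomials n d - ?M", where 'k = 'k] finite_monomials
    by (simp add: hilb_def hom_comp_eq)
  also have "\<dots> = card (monomials n d \<inter> ?M)"
    using card_Diff_subset_Int[of "monomials n d" ?M] finite_monomials[of n d]
      card_mono[OF finite_monomials, of "monomials n d \<inter> ?M" n d] by simp
  also have "monomials n d \<inter> ?M = slice ?M d"
    unfolding monomials_def slice_def using std_monomials_keys by blast
  finally show ?thesis .
qed

lemma symmetric_about_if_hilb_symmetric:
  assumes "hilb_symmetric (\<lambda>d. card (slice M d))" "finite M"
  shows "\<exists>c. symmetric_about M c"
proof -
  let ?h = "\<lambda>d. card (slice M d)"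
  obtain b t where bt: "?h b \<noteq> 0" "?h t \<noteq> 0" and range: "\<And>i. ?h i \<noteq> 0 \<Longrightarrow> b \<le> i \<and> i \<le> t"
    and sym: "\<And>i. i \<le> t - b \<Longrightarrow> ?h (b + i) = ?h (t - i)"
    using assms(1) unfolding hilb_symmetric_def by blast
  have sym': "?h d = ?h (b + t - d)" if "?h d \<noteq> 0" for d
  proof -
    have "b \<le> d" "d \<le> t" using range[OF that] by auto
    then show ?thesis using sym[of "d - b"] by (simp add: diff_le_mono add.commute)
  qed
  have "mdeg m \<le> b + t" if "m \<in> M" for m
  proof -
    have "m \<in> slice M (mdeg m)" using that by (simp add: slice_def)
    moreover have "finite (slice M (mdeg m))" by (rule finite_subset[OF slice_subset assms(2)])
    ultimately have "?h (mdeg m) \<noteq> 0" by (metis card_0_eq empty_iff)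
    then show ?thesis using range[of "mdeg m"] by linarith
  qed
  \<comment> \<open>\<open>sym'\<close> needs a nonzero value. If \<open>?h d\<close> vanishes, it
    is applied to the reflected degree; if both vanish, they agree.\<close>
  moreover have "?h d = ?h (b + t - d)" if "d \<le> b + t" for d
    using sym'[of d] sym'[of "b + t - d"] that by (metis diff_diff_cancel)
  ultimately show ?thesis unfolding symmetric_about_def by blast
qed

text \<open>Divisors of standard monomials are standard, so no multiple of a discarded monomial is
  standard. Hence products can be computed on normal forms.\<close>

lemma trunc_std_mult_trunc:
  "trunc (std_monomials n a p {..<n}) (x * trunc (std_monomials n a p {..<n}) f) =
    trunc (std_monomials n a p {..<n}) (x * f)"
proof -
  let ?M = "std_monomials n a p {..<n}"
  have "lookup (x * (f - trunc ?M f)) u = 0" if u: "u \<in> ?M" for u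
  proof (rule ccontr)
    assume "lookup (x * (f - trunc ?M f)) u \<noteq> 0"
    then obtain y m where m: "m \<in> keys (f - trunc ?M f)" "u = y + m"
      using keys_mult[of x "f - trunc ?M f"] by (auto simp: in_keys_iff[symmetric])
    have "m \<notin> ?M" using m(1) by (auto simp: in_keys_iff lookup_minus lookup_trunc)
    moreover have "m \<in> ?M"
    proof -
      have le: "lookup m i \<le> lookup u i" for i by (simp add: m(2) lookup_add)
      have "lookup m i < x" if "lookup u i < x" for i x using le[of i] that by linarith
      moreover have "lookup m i = 0" if "lookup u i = 0" for i using le[of i] that by simp
      ultimately show ?thesis using u unfolding std_monomials_def by blast
    qed
    ultimately show False by blast
  qed
  then have "trunc ?M (x * (f - trunc ?M f)) = 0" by (simp add: trunc_eq_0_iff)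
  then show ?thesis by (simp add: right_diff_distrib trunc_diff)
qed

text \<open>An injective linear map between spaces of equal finite dimension is onto: the image of
  the monomial basis is independent and has as many elements as the basis of the target.\<close>

lemma lefschetz_on_surjective:
  fixes g :: "'k::field mpoly"
  assumes lef: "lefschetz_on TYPE('k) n M c" and s: "s + 2 * d \<le> c"
    and M: "finite M" "\<And>m. m \<in> M \<Longrightarrow> keys m \<subseteq> {..<n}"
    and card: "card (slice M d) = card (slice M (d + s))"
    and g: "keys g \<subseteq> slice M (d + s)"
  shows "\<exists>f. keys f \<subseteq> slice M d \<and> trunc M (lin n ^ s * f) = g"
proof -
  define L :: "'k mpoly \<Rightarrow> 'k mpoly" where "L f = trunc M (lin n ^ s * f)" for f
  interpret L: module_hom pscale pscale L
  proof
    show "L (f + g) = L f + L g" for f g by (simp add: L_def distrib_left trunc_add)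
    have "lin n ^ s * pscale x f = pscale x (lin n ^ s * f)" for x :: 'k and f
      by (simp add: pscale_def mult.left_commute)
    then show "L (pscale x f) = pscale x (L f)" for x f
      by (auto intro!: poly_mapping_eqI simp: L_def lookup_trunc lookup_pscale)
  qed
  have fin: "finite (slice M e)" for e by (rule finite_subset[OF slice_subset M(1)])
  note span = span_monomials[OF fin, where 'k = 'k]
  let ?B = "\<lambda>e. mono1 ` slice M e :: 'k mpoly set"
  have "f = 0" if "f \<in> pscale.span (?B d)" "L f = 0" for f
    using lef s that unfolding lefschetz_on_def span L_def by blast
  then have inj: "inj_on L (pscale.span (?B d))"
    using L.inj_on_iff_eq_0[OF pscale.subspace_span] by blast
  have L_span: "L f \<in> pscale.span (?B (d + s))" if "f \<in> pscale.span (?B d)" for f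
  proof -
    have "f \<in> hom_comp n d"
      using that M(2) unfolding span hom_comp_eq by (auto simp: slice_def monomials_def)
    from lin_pow_mult_hom_comp[OF this] show ?thesis
      unfolding span L_def hom_comp_eq by (auto simp: keys_trunc slice_def monomials_def)
  qed
  have "pscale.span (L ` ?B d) = pscale.span (?B (d + s))"
  proof (rule pscale.span_eq_if_independent_card)
    show "pscale.independent (L ` ?B d)"
      by (rule L.independent_injective_image[OF independent_monomials[OF fin] inj])
    show "L ` ?B d \<subseteq> pscale.span (?B (d + s))" using L_span pscale.span_base by blast
    show "finite (?B (d + s))" using fin by simp
    have "inj_on L (?B d)" by (rule inj_on_subset[OF inj pscale.span_superset])
    then show "card (L ` ?B d) = card (?B (d + s))"
      using card by (simp add: card_image card_mono1_image)
  qed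
  then have "g \<in> L ` pscale.span (?B d)" using g unfolding L.span_image span by blast
  then show ?thesis unfolding span L_def by blast
qed

theorem theorem4p3:
  fixes n :: nat and a p :: "nat \<Rightarrow> nat"
  assumes "\<forall>i<n. p i < a i"
    and "hilb_symmetric (hilb n a p TYPE('k::field_char_0))"
  shows "has_SLP n a p TYPE('k::field_char_0)"
proof -
  let ?M = "std_monomials n a p {..<n}"
  let ?l = "lin n :: 'k mpoly"
  have "hilb n a p TYPE('k) = (\<lambda>d. card (slice ?M d))" by (rule ext) (rule hilb_eq)
  then obtain c where c: "symmetric_about ?M c"
    using assms(2) symmetric_about_if_hilb_symmetric[OF _ finite_std_monomials] by metis
  have lef: "lefschetz_on TYPE('k) n ?M c"
    using lefschetz_on_std_monomials[OF assms(1) _ c] by blast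
  have inj: "f \<in> the_ideal n a p"
    if f: "f \<in> hom_comp n i" and lf: "?l ^ t * f \<in> the_ideal n a p" and t: "t + 2 * i \<le> c" for t i f
  proof -
    have "trunc ?M (?l ^ t * trunc ?M f) = 0"
      using lf in_ideal_iff[OF hom_comp_polyring[OF lin_pow_mult_hom_comp[OF f]]]
      by (simp add: trunc_std_mult_trunc)
    moreover have "keys (trunc ?M f) \<subseteq> slice ?M i"
      using f by (auto simp: keys_trunc slice_def hom_comp_eq monomials_def)
    ultimately have "trunc ?M f = 0" using lef t unfolding lefschetz_on_def by blast
    then show ?thesis using in_ideal_iff[OF hom_comp_polyring[OF f]] by blast
  qed
  have surj: "\<exists>f\<in>hom_comp n i. g - ?l ^ t * f \<in> the_ideal n a p"
    if g: "g \<in> hom_comp n (i + t)" and t: "c < t + 2 * i" for t i g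
  proof -
    have keys_g: "keys (trunc ?M g) \<subseteq> slice ?M (i + t)"
      using g by (auto simp: keys_trunc slice_def hom_comp_eq monomials_def)
    obtain f where f: "f \<in> hom_comp n i" "trunc ?M (?l ^ t * f) = trunc ?M g"
    proof (cases "i + t \<le> c")
      case False
      \<comment> \<open>Above degree \<open>c\<close> the quotient ring is zero, so \<open>0\<close>
        is a preimage.\<close>
      then have "slice ?M (i + t) = {}" using c by (auto simp: slice_def symmetric_about_def)
      then have "trunc ?M g = 0" using keys_g by simp
      moreover have "trunc ?M (0 :: 'k mpoly) = 0" by (simp add: trunc_eq_0_iff)
      ultimately show ?thesis using that[of 0] by (simp add: hom_comp_eq)
    next
      case True
      \<comment> \<open>\<open>d\<close> is the reflection of the target degree
        \<open>i + t\<close>, and it lies below \<open>i\<close> because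
        \<open>c < t + 2 * i\<close>. The power \<open>s\<close>, with \<open>s + 2 * d = c\<close>,
        maps degree \<open>d\<close> onto degree \<open>i + t\<close>. Since
        \<open>s = t + (i - d)\<close>, this map factors through degree \<open>i\<close>, so its
        last factor, multiplication by the power \<open>t\<close>, is onto.\<close>
      define d where "d = c - (i + t)"
      define s where "s = i + t - d"
      have d: "d < i" "d + s = i + t" "s + 2 * d \<le> c" "s = t + (i - d)" "c - d = i + t" "d \<le> c"
        using True t by (auto simp: d_def s_def)
      have "card (slice ?M d) = card (slice ?M (d + s))"
        using c d(2,5,6) unfolding symmetric_about_def by metis
      then have "\<exists>f0. keys f0 \<subseteq> slice ?M d \<and> trunc ?M (?l ^ s * f0) = trunc ?M g"
        using keys_g std_monomials_keys d(2)
        by (intro lefschetz_on_surjective[OF lef d(3) finite_std_monomials]) simp_all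
      then obtain f0 where f0: "keys f0 \<subseteq> slice ?M d" "trunc ?M (?l ^ s * f0) = trunc ?M g"
        by blast
      have "f0 \<in> hom_comp n d"
        using f0(1) std_monomials_keys unfolding hom_comp_eq slice_def monomials_def by blast
      then have "?l ^ (i - d) * f0 \<in> hom_comp n i"
        using lin_pow_mult_hom_comp[of f0 n d "i - d"] d(1) by simp
      moreover have "?l ^ t * (?l ^ (i - d) * f0) = ?l ^ s * f0"
        unfolding d(4) by (simp add: power_add mult.assoc)
      ultimately show ?thesis using that f0(2) by metis
    qed
    have "g - ?l ^ t * f \<in> hom_comp n (i + t)"
      using g lin_pow_mult_hom_comp[OF f(1), of t] by (auto simp: hom_comp_eq keys_subset_iff lookup_minus)
    moreover have "trunc ?M (g - ?l ^ t * f) = 0" by (simp add: trunc_diff f(2))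
    ultimately show ?thesis using in_ideal_iff[OF hom_comp_polyring] f(1) by blast
  qed
  show ?thesis
    unfolding has_SLP_def
  proof (intro exI[of _ ?l] conjI allI impI)
    fix t i :: nat
    show "(\<forall>f\<in>hom_comp n i. ?l ^ t * f \<in> the_ideal n a p \<longrightarrow> f \<in> the_ideal n a p) \<or>
        (\<forall>g\<in>hom_comp n (i + t). \<exists>f\<in>hom_comp n i. g - ?l ^ t * f \<in> the_ideal n a p)"
      using inj surj by (cases "t + 2 * i \<le> c") (auto simp: not_le)
  qed (rule lin_hom_comp)
qed

end
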